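(* Let $f:\mathbb{R}^n\to\mathbb{R}$ be a convex $(L_0^f,L_1^f)$-smooth function, let $\beta>0$, and let $y_k$ be a dual iterate generated by the inexact augmented Lagrangian method (iALM) described in the context. Let $$\mathcal{L}(x)=f(x)+y_k^\top(Ax-b)+\frac{\beta}{2}\|Ax-b\|^2,$$ let $x_s$ be the starting point of the subproblem of minimizing $\mathcal{L}$, and define the sublevel set $S:=\{x:\mathcal{L}(x)\le\mathcal{L}(x_s)\}$. Then $\mathcal{L}$ is $(L_0^{\mathcal{L}},L_1^f)$-smooth on $S$, i.e. $$\|\nabla^2\mathcal{L}(x)\|\le L_0^{\mathcal{L}}+L_1^f\|\nabla\mathcal{L}(x)\|\qquad\text{for all }x\in S,$$ where $$L_0^{\mathcal{L}}=L_0^f+\beta\|A^\top A\|+L_1^fB_S,\qquad B_S=\|A\|\,(Y+\beta R_S),$$ $$R_S=\sqrt{\frac{2(\mathcal{L}(x_s)-f^\star)}{\beta}+\frac{Y^2}{\beta^2}}+\frac{Y}{\beta},\qquad Y=2\|y^\star\|+\sqrt{C_\varepsilon}.$$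
   Context: Norms are the Euclidean norm for vectors and the spectral norm for matrices. A twice differentiable function $h$ is $(L_0,L_1)$-smooth, with constants $L_0,L_1>0$, if $\|\nabla^2h(x)\|\le L_0+L_1\|\nabla h(x)\|$ for all $x$. Problem: $\min_{x\in Q}f(x)$ subject to $Ax=b$, where $Q\subset\mathbb{R}^n$ is convex and compact, $A\in\mathbb{R}^{m\times n}$, $b\in\mathbb{R}^m$. It is assumed that a KKT point $(x^\star,y^\star)$ exists: $0\in\nabla f(x^\star)+A^\top y^\star+N_Q(x^\star)$ and $Ax^\star=b$, where $N_Q$ is the normal cone of $Q$. The symbol $f^\star$ denotes the (finite) infimum of $f$, so that $f(x)\ge f^\star$ for all $x$. Augmented Lagrangian: $\mathcal{L}_{\beta}(x,y)=f(x)+y^\top(Ax-b)+\frac{\beta}{2}\|Ax-b\|^2$. iALM: given $x^0\in Q$, $y^0=0$, penalties $\{\beta_k\}$ and accuracies $\{\varepsilon_k\}$, for $k=0,\dots,K-1$ compute $x^{k+1}\in Q$ with $\mathcal{L}_{\beta_k}(x^{k+1},y^k)-\min_{x\in Q}\mathcal{L}_{\beta_k}(x,y^k)\le\varepsilon_k$ and set $y^{k+1}=y^k+\beta_k(Ax^{k+1}-b)$. The dual iterate $y^k$ is also written $y_k$. The parameters are $\beta_k=\rho_k=\frac{C_\beta}{K\varepsilon}$ for all $k=0,\dots,K-1$, with constants $C_\beta>0$ and target accuracy $\varepsilon>0$, and the accuracies $\varepsilon_k$ satisfy $\sum_{k=0}^{K-1}\rho_k\varepsilon_k\le\frac{C_\varepsilon}{2}$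 with a constant $C_\varepsilon>0$. *)

theory Defs
  imports "HOL-Analysis.Analysis"
begin

definition grad :: "(real ^ 'n \<Rightarrow> real) \<Rightarrow> real ^ 'n \<Rightarrow> real ^ 'n"
  where "grad h x = (THE D. GDERIV h x :> D)"

definition hessian :: "(real ^ 'n \<Rightarrow> real) \<Rightarrow> real ^ 'n \<Rightarrow> real ^ 'n ^ 'n"
  where "hessian h x = jacobian (grad h) (at x)"

definition twice_differentiable :: "(real ^ 'n \<Rightarrow> real) \<Rightarrow> bool"
  where "twice_differentiable h \<longleftrightarrow>
    (\<forall>x. h differentiable (at x)) \<and> (\<forall>x. grad h differentiable (at x))"

text \<open>The type class norm on matrices is the Frobenius norm; the spectral norm is the
  operator norm induced by the Euclidean norms.\<close>

definition spectral_norm :: "real ^ 'n ^ 'm \<Rightarrow> real"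
  where "spectral_norm M = onorm ((*v) M)"

definition L0_L1_smooth_on ::
    "(real ^ 'n) set \<Rightarrow> (real ^ 'n \<Rightarrow> real) \<Rightarrow> real \<Rightarrow> real \<Rightarrow> bool"
  where "L0_L1_smooth_on S h L0 L1 \<longleftrightarrow>
    0 < L0 \<and> 0 < L1 \<and> twice_differentiable h \<and>
    (\<forall>x\<in>S. spectral_norm (hessian h x) \<le> L0 + L1 * norm (grad h x))"

abbreviation L0_L1_smooth :: "(real ^ 'n \<Rightarrow> real) \<Rightarrow> real \<Rightarrow> real \<Rightarrow> bool"
  where "L0_L1_smooth \<equiv> L0_L1_smooth_on UNIV"

text \<open>Normal cone of convex analysis, empty at points outside \<open>Q\<close>.\<close>

definition normal_cone :: "'a::real_inner set \<Rightarrow> 'a \<Rightarrow> 'a set"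
  where "normal_cone Q x = {v. x \<in> Q \<and> (\<forall>z\<in>Q. v \<bullet> (z - x) \<le> 0)}"

definition KKT_point ::
    "(real ^ 'n \<Rightarrow> real) \<Rightarrow> (real ^ 'n) set \<Rightarrow> real ^ 'n ^ 'm \<Rightarrow> real ^ 'm \<Rightarrow>
     real ^ 'n \<Rightarrow> real ^ 'm \<Rightarrow> bool"
  where "KKT_point f Q A b x y \<longleftrightarrow>
    0 \<in> {grad f x + transpose A *v y + v | v. v \<in> normal_cone Q x} \<and> A *v x = b"

definition aug_lagrangian ::
    "(real ^ 'n \<Rightarrow> real) \<Rightarrow> real ^ 'n ^ 'm \<Rightarrow> real ^ 'm \<Rightarrow> real \<Rightarrow>
     real ^ 'n \<Rightarrow> real ^ 'm \<Rightarrow> real"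
  where "aug_lagrangian f A b \<beta> x y =
    f x + y \<bullet> (A *v x - b) + \<beta> / 2 * (norm (A *v x - b))\<^sup>2"

text \<open>The sequences \<open>xs\<close>, \<open>ys\<close> are a possible run of \<open>K\<close> steps of the inexact augmented
  Lagrangian method with penalties \<open>\<beta>s\<close> and accuracies \<open>\<epsilon>s\<close>; only the entries with index
  at most \<open>K\<close> are constrained. The infimum over \<open>Q\<close> is a minimum when \<open>f\<close> is continuous and
  \<open>Q\<close> is compact.\<close>

definition iALM ::
    "(real ^ 'n \<Rightarrow> real) \<Rightarrow> (real ^ 'n) set \<Rightarrow> real ^ 'n ^ 'm \<Rightarrow> real ^ 'm \<Rightarrow>
     nat \<Rightarrow> (nat \<Rightarrow> real) \<Rightarrow> (nat \<Rightarrow> real) \<Rightarrow>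
     (nat \<Rightarrow> real ^ 'n) \<Rightarrow> (nat \<Rightarrow> real ^ 'm) \<Rightarrow> bool"
  where "iALM f Q A b K \<beta>s \<epsilon>s xs ys \<longleftrightarrow>
    xs 0 \<in> Q \<and> ys 0 = 0 \<and>
    (\<forall>k<K. xs (Suc k) \<in> Q \<and>
      aug_lagrangian f A b (\<beta>s k) (xs (Suc k)) (ys k)
        - (INF x\<in>Q. aug_lagrangian f A b (\<beta>s k) x (ys k)) \<le> \<epsilon>s k \<and>
      ys (Suc k) = ys k + \<beta>s k *\<^sub>R (A *v xs (Suc k) - b))"

end

theory Submission
  imports Defs
begin

text \<open>
  Write \<open>r(x) = A x - b\<close> and \<open>y = y\<^sub>k\<close>. The augmented Lagrangian \<open>L\<close> has gradient
  \<open>\<nabla>f(x) + A\<^sup>T (y + \<beta> r(x))\<close> and Hessian \<open>\<nabla>\<^sup>2f(x) + \<beta> A\<^sup>T A\<close>. Bounding the Hessian of \<open>f\<close> by the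
  smoothness of \<open>f\<close>, and then \<open>\<nabla>f\<close> by \<open>\<nabla>L\<close>, reduces the claim to \<open>norm (A\<^sup>T (y + \<beta> r(x))) \<le> B\<^sub>S\<close>
  on \<open>S\<close> (\<open>aug_lagrangian_hessian_bound\<close>), for which \<open>norm y \<le> Y\<close> and \<open>norm (r(x)) \<le> R\<^sub>S\<close> suffice.

  The bound on the multiplier (\<open>iALM_dual_bound\<close>) holds because, up to the errors, the dual
  iterates do not move away from \<open>ystar\<close>: comparing the inexact minimiser \<open>xs (j + 1)\<close> with the feasible
  point \<open>xstar\<close>, and using \<open>f x \<ge> f xstar - ystar \<bullet> r(x)\<close> on \<open>Q\<close> (\<open>KKT_saddle\<close>), gives
  \<open>(norm (ys (j + 1) - ystar))\<^sup>2 \<le> (norm (ys j - ystar))\<^sup>2 + 2 \<beta>\<^sub>j \<epsilon>\<^sub>j\<close>. Summing from \<open>ys 0 = 0\<close>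
  yields \<open>(norm (ys k - ystar))\<^sup>2 \<le> (norm ystar)\<^sup>2 + C\<epsilon>\<close>.

  The bound on the residual (\<open>residual_bound\<close>) follows from \<open>L x \<le> L x\<^sub>s\<close> and \<open>f x \<ge> fstar\<close>, which give
  a quadratic inequality for \<open>norm (r(x))\<close>; completing the square solves it.
\<close>

section \<open>The spectral norm\<close>

lemma norm_mult_vec_le_spectral_norm:
  fixes M :: "real ^ 'n ^ 'm"
  shows "norm (M *v v) \<le> spectral_norm M * norm v"
  unfolding spectral_norm_def by (rule onorm) (rule matrix_vector_mul_bounded_linear)

lemma spectral_norm_nonneg:
  fixes M :: "real ^ 'n ^ 'm"
  shows "0 \<le> spectral_norm M"
  unfolding spectral_norm_def by (rule onorm_pos_le) (rule matrix_vector_mul_bounded_linear)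

lemma spectral_norm_add_le:
  fixes M N :: "real ^ 'n ^ 'm"
  shows "spectral_norm (M + N) \<le> spectral_norm M + spectral_norm N"
proof -
  have "((*v) (M + N)) = (\<lambda>v. M *v v + N *v v)"
    by (simp add: fun_eq_iff matrix_vector_mult_add_rdistrib)
  then show ?thesis
    unfolding spectral_norm_def
    by (simp add: onorm_triangle matrix_vector_mul_bounded_linear)
qed

lemma spectral_norm_scaleR:
  fixes M :: "real ^ 'n ^ 'm"
  shows "spectral_norm (c *\<^sub>R M) = \<bar>c\<bar> * spectral_norm M"
proof -
  have "((*v) (c *\<^sub>R M)) = (\<lambda>v. c *\<^sub>R (M *v v))"
    by (simp add: fun_eq_iff scaleR_matrix_vector_assoc)
  then show ?thesis
    unfolding spectral_norm_def
    by (simp add: onorm_scaleR matrix_vector_mul_bounded_linear)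
qed

lemma inner_transpose_mult_vec:
  fixes M :: "real ^ 'n ^ 'm"
  shows "(transpose M *v w) \<bullet> v = w \<bullet> (M *v v)"
  by (simp add: dot_lmul_matrix)

lemma norm_transpose_mult_vec_le_spectral_norm:
  fixes M :: "real ^ 'n ^ 'm"
  shows "norm (transpose M *v w) \<le> spectral_norm M * norm w"
proof (cases "transpose M *v w = 0")
  case True
  then show ?thesis by (simp add: spectral_norm_nonneg)
next
  case False
  let ?u = "transpose M *v w"
  have "norm ?u * norm ?u = w \<bullet> (M *v ?u)"
    using inner_transpose_mult_vec[of M w ?u] by (simp add: power2_norm_eq_inner flip: power2_eq_square)
  also have "\<dots> \<le> norm w * norm (M *v ?u)"
    by (rule norm_cauchy_schwarz)
  also have "\<dots> \<le> norm w * (spectral_norm M * norm ?u)"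
    by (intro mult_left_mono norm_mult_vec_le_spectral_norm norm_ge_zero)
  finally have "norm ?u * norm ?u \<le> (spectral_norm M * norm w) * norm ?u"
    by (simp add: mult_ac)
  with False show ?thesis by (simp only: mult_le_cancel_right) (simp add: not_less)
qed

section \<open>Gradients and Hessians\<close>

lemma grad_eqI:
  assumes "GDERIV h x :> D"
  shows "grad h x = D"
  unfolding grad_def
proof (rule the_equality)
  show "GDERIV h x :> D" by fact
next
  fix D' assume "GDERIV h x :> D'"
  then have "(\<lambda>v. v \<bullet> D') = (\<lambda>v. v \<bullet> D)"
    using assms unfolding gderiv_def by (rule has_derivative_unique)
  then show "D' = D"
    by (metis vector_eq_ldot)
qed

text \<open>The gradient is defined by a definite description, so its existence has to be shown; the
  representing vector of the derivative is the value of its adjoint at \<open>1\<close>.\<close>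

lemma GDERIV_grad:
  fixes h :: "real ^ 'n \<Rightarrow> real"
  assumes "h differentiable (at x)"
  shows "GDERIV h x :> grad h x"
proof -
  from assms obtain h' where h': "(h has_derivative h') (at x)"
    by (auto simp: differentiable_def)
  then have "linear h'" by (rule has_derivative_linear)
  then have "h' = (\<lambda>v. v \<bullet> adjoint h' 1)"
    by (simp add: fun_eq_iff adjoint_works)
  with h' have "GDERIV h x :> adjoint h' 1" by (simp add: gderiv_def)
  with grad_eqI[OF this] show ?thesis by simp
qed

lemma hessian_eqI:
  fixes h :: "real ^ 'n \<Rightarrow> real"
  assumes "(grad h has_derivative ((*v) H)) (at x)"
  shows "hessian h x = H"
  unfolding hessian_def jacobian_def
  by (simp flip: frechet_derivative_at[OF assms])

lemma grad_has_derivative_hessian: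
  fixes h :: "real ^ 'n \<Rightarrow> real"
  assumes "grad h differentiable (at x)"
  shows "(grad h has_derivative ((*v) (hessian h x))) (at x)"
  using assms unfolding hessian_def by (simp add: jacobian_works)

lemma convex_on_above_tangent_plane:
  fixes f :: "real ^ 'n \<Rightarrow> real"
  assumes "convex_on UNIV f" and "GDERIV f x :> D"
  shows "f x + D \<bullet> (z - x) \<le> f z"
proof -
  \<comment> \<open>Restrict to the line through \<open>x\<close> and \<open>z\<close>, where the one-dimensional tangent inequality applies.\<close>
  define g where "g = (\<lambda>t::real. f (x + t *\<^sub>R (z - x)))"
  have "convex_on UNIV g"
  proof (rule convex_onI)
    fix t s u :: real assume t: "0 < t" "t < 1"
    have "x + ((1 - t) * s + t * u) *\<^sub>R (z - x)
        = (1 - t) *\<^sub>R (x + s *\<^sub>R (z - x)) + t *\<^sub>R (x + u *\<^sub>R (z - x))"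
      by (simp add: algebra_simps)
    then show "g ((1 - t) *\<^sub>R s + t *\<^sub>R u) \<le> (1 - t) * g s + t * g u"
      using convex_onD[OF assms(1), of t] t by (simp add: g_def)
  qed simp
  moreover have "(g has_field_derivative D \<bullet> (z - x)) (at 0)"
  proof -
    have "(f has_derivative (\<lambda>v. v \<bullet> D)) (at (x + 0 *\<^sub>R (z - x)))"
      using assms(2) by (simp add: gderiv_def)
    moreover have "((\<lambda>t. x + t *\<^sub>R (z - x)) has_derivative (\<lambda>t. t *\<^sub>R (z - x))) (at 0)"
      by (auto intro!: derivative_eq_intros)
    ultimately have "(g has_derivative (\<lambda>t. (t *\<^sub>R (z - x)) \<bullet> D)) (at 0)"
      unfolding g_def by (rule has_derivative_compose[rotated])
    then show ?thesis
      by (simp add: has_field_derivative_def inner_commute mult_commute_abs)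
  qed
  ultimately have "g 1 - g 0 \<ge> D \<bullet> (z - x) * (1 - 0)"
    by (intro convex_on_imp_above_tangent[of UNIV]) auto
  then show ?thesis by (simp add: g_def)
qed

section \<open>Derivatives of the augmented Lagrangian\<close>

lemma GDERIV_aug_lagrangian:
  fixes f :: "real ^ 'n \<Rightarrow> real" and A :: "real ^ 'n ^ 'm"
  assumes "GDERIV f x :> D"
  shows "GDERIV (\<lambda>x. aug_lagrangian f A b \<beta> x y) x
    :> D + transpose A *v (y + \<beta> *\<^sub>R (A *v x - b))"
proof -
  have r: "((\<lambda>x. A *v x - b) has_derivative (\<lambda>v. A *v v)) (at x)"
    by (auto intro!: derivative_eq_intros bounded_linear_imp_has_derivative
        matrix_vector_mul_bounded_linear)
  have "((\<lambda>x. f x + y \<bullet> (A *v x - b) + \<beta> / 2 * ((A *v x - b) \<bullet> (A *v x - b)))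
      has_derivative (\<lambda>v. v \<bullet> D + y \<bullet> (A *v v)
        + \<beta> / 2 * ((A *v x - b) \<bullet> (A *v v) + (A *v v) \<bullet> (A *v x - b)))) (at x)"
    using assms r unfolding gderiv_def
    by (intro has_derivative_add has_derivative_inner_right has_derivative_mult_right
        has_derivative_inner)
  also have "(\<lambda>v. v \<bullet> D + y \<bullet> (A *v v)
        + \<beta> / 2 * ((A *v x - b) \<bullet> (A *v v) + (A *v v) \<bullet> (A *v x - b)))
      = (\<lambda>v. v \<bullet> (D + transpose A *v (y + \<beta> *\<^sub>R (A *v x - b))))"
  proof
    fix v
    have "v \<bullet> (transpose A *v (y + \<beta> *\<^sub>R (A *v x - b)))
        = y \<bullet> (A *v v) + \<beta> * ((A *v x - b) \<bullet> (A *v v))"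
      by (metis inner_add_left inner_commute inner_scaleR_left inner_transpose_mult_vec)
    then show "v \<bullet> D + y \<bullet> (A *v v)
        + \<beta> / 2 * ((A *v x - b) \<bullet> (A *v v) + (A *v v) \<bullet> (A *v x - b))
      = v \<bullet> (D + transpose A *v (y + \<beta> *\<^sub>R (A *v x - b)))"
      by (simp add: inner_add_right inner_commute[of "A *v v"])
  qed
  finally show ?thesis
    by (simp add: gderiv_def aug_lagrangian_def power2_norm_eq_inner)
qed

lemma grad_aug_lagrangian:
  fixes f :: "real ^ 'n \<Rightarrow> real" and A :: "real ^ 'n ^ 'm"
  assumes "f differentiable (at x)"
  shows "grad (\<lambda>x. aug_lagrangian f A b \<beta> x y) x
    = grad f x + transpose A *v (y + \<beta> *\<^sub>R (A *v x - b))"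
  by (rule grad_eqI[OF GDERIV_aug_lagrangian[OF GDERIV_grad[OF assms]]])

lemma grad_aug_lagrangian_has_derivative:
  fixes f :: "real ^ 'n \<Rightarrow> real" and A :: "real ^ 'n ^ 'm"
  assumes "twice_differentiable f"
  shows "(grad (\<lambda>x. aug_lagrangian f A b \<beta> x y) has_derivative
    ((*v) (hessian f x + \<beta> *\<^sub>R (transpose A ** A)))) (at x)"
proof -
  have grad: "grad (\<lambda>x. aug_lagrangian f A b \<beta> x y)
      = (\<lambda>x. grad f x + transpose A *v (y + \<beta> *\<^sub>R (A *v x - b)))"
    using assms by (simp add: fun_eq_iff grad_aug_lagrangian twice_differentiable_def)
  have "((\<lambda>x. y + \<beta> *\<^sub>R (A *v x - b)) has_derivative (\<lambda>v. \<beta> *\<^sub>R (A *v v))) (at x)"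
    by (auto intro!: derivative_eq_intros bounded_linear_imp_has_derivative
        matrix_vector_mul_bounded_linear)
  then have "((\<lambda>x. transpose A *v (y + \<beta> *\<^sub>R (A *v x - b)))
      has_derivative (\<lambda>v. transpose A *v (\<beta> *\<^sub>R (A *v v)))) (at x)"
    by (rule bounded_linear.has_derivative[OF matrix_vector_mul_bounded_linear])
  with grad_has_derivative_hessian[of f x] assms
  have "((\<lambda>x. grad f x + transpose A *v (y + \<beta> *\<^sub>R (A *v x - b)))
      has_derivative (\<lambda>v. hessian f x *v v + transpose A *v (\<beta> *\<^sub>R (A *v v)))) (at x)"
    by (intro has_derivative_add) (auto simp: twice_differentiable_def)
  moreover have "(\<lambda>v. hessian f x *v v + transpose A *v (\<beta> *\<^sub>R (A *v v)))
      = (*v) (hessian f x + \<beta> *\<^sub>R (transpose A ** A))"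
    by (simp add: fun_eq_iff matrix_vector_mult_add_rdistrib matrix_vector_mult_scaleR
        matrix_vector_mul_assoc flip: scaleR_matrix_vector_assoc)
  ultimately show ?thesis by (simp add: grad)
qed

lemma twice_differentiable_aug_lagrangian:
  fixes f :: "real ^ 'n \<Rightarrow> real" and A :: "real ^ 'n ^ 'm"
  assumes "twice_differentiable f"
  shows "twice_differentiable (\<lambda>x. aug_lagrangian f A b \<beta> x y)"
  unfolding twice_differentiable_def
proof (intro conjI allI)
  fix x
  have "GDERIV f x :> grad f x"
    using assms by (simp add: GDERIV_grad twice_differentiable_def)
  from GDERIV_aug_lagrangian[OF this]
  show "(\<lambda>x. aug_lagrangian f A b \<beta> x y) differentiable (at x)"
    unfolding gderiv_def by (rule differentiableI)
  show "grad (\<lambda>x. aug_lagrangian f A b \<beta> x y) differentiable (at x)"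
    using grad_aug_lagrangian_has_derivative[OF assms] by (rule differentiableI)
qed

text \<open>The bound on the Hessian at a single point, in terms of bounds on the multiplier and on the
  residual at that point.\<close>

lemma aug_lagrangian_hessian_bound:
  fixes f :: "real ^ 'n \<Rightarrow> real" and A :: "real ^ 'n ^ 'm"
  assumes f: "L0_L1_smooth f L0 L1" and "0 \<le> \<beta>"
    and "norm y \<le> Y" and "norm (A *v x - b) \<le> R"
  shows "spectral_norm (hessian (\<lambda>x. aug_lagrangian f A b \<beta> x y) x)
    \<le> L0 + \<beta> * spectral_norm (transpose A ** A) + L1 * (spectral_norm A * (Y + \<beta> * R))
      + L1 * norm (grad (\<lambda>x. aug_lagrangian f A b \<beta> x y) x)"
proof -
  let ?L = "\<lambda>x. aug_lagrangian f A b \<beta> x y"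
  let ?w = "y + \<beta> *\<^sub>R (A *v x - b)"
  have f2: "twice_differentiable f" and "0 < L1"
    and fx: "spectral_norm (hessian f x) \<le> L0 + L1 * norm (grad f x)"
    using f by (auto simp: L0_L1_smooth_on_def)
  have "norm ?w \<le> norm y + \<beta> * norm (A *v x - b)"
    using norm_triangle_ineq[of y "\<beta> *\<^sub>R (A *v x - b)"] \<open>0 \<le> \<beta>\<close> by simp
  also have "\<dots> \<le> Y + \<beta> * R"
    using assms by (intro add_mono mult_left_mono)
  finally have "norm (transpose A *v ?w) \<le> spectral_norm A * (Y + \<beta> * R)"
    using norm_transpose_mult_vec_le_spectral_norm[of A ?w]
      mult_left_mono[OF _ spectral_norm_nonneg[of A]] order_trans by blast
  moreover have "grad f x = grad ?L x - transpose A *v ?w"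
    using f2 by (simp add: grad_aug_lagrangian twice_differentiable_def)
  ultimately have "norm (grad f x) \<le> norm (grad ?L x) + spectral_norm A * (Y + \<beta> * R)"
    using norm_triangle_ineq4[of "grad ?L x" "transpose A *v ?w"] by simp
  then have "L1 * norm (grad f x) \<le> L1 * (norm (grad ?L x) + spectral_norm A * (Y + \<beta> * R))"
    using \<open>0 < L1\<close> by (intro mult_left_mono) auto
  moreover have "spectral_norm (hessian ?L x)
      \<le> spectral_norm (hessian f x) + \<beta> * spectral_norm (transpose A ** A)"
    unfolding hessian_eqI[OF grad_aug_lagrangian_has_derivative[OF f2]]
    using \<open>0 \<le> \<beta>\<close>
      spectral_norm_add_le[of "hessian f x" "\<beta> *\<^sub>R (transpose A ** A)"]
    by (simp add: spectral_norm_scaleR)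
  ultimately show ?thesis
    using fx by (simp add: distrib_left)
qed

section \<open>Boundedness of the dual iterates\<close>

text \<open>Half of the saddle point property: \<open>xstar\<close> minimises the Lagrangian with multiplier \<open>ystar\<close>
  over \<open>Q\<close>.\<close>

lemma KKT_saddle:
  fixes f :: "real ^ 'n \<Rightarrow> real" and A :: "real ^ 'n ^ 'm"
  assumes "convex_on UNIV f" and "f differentiable (at xstar)"
    and "KKT_point f Q A b xstar ystar" and "x \<in> Q"
  shows "f xstar - ystar \<bullet> (A *v x - b) \<le> f x"
proof -
  obtain v where v: "v \<in> normal_cone Q xstar" "grad f xstar + transpose A *v ystar + v = 0"
    and b: "A *v xstar = b"
    using assms(3) unfolding KKT_point_def by force
  have "(grad f xstar + transpose A *v ystar + v) \<bullet> (x - xstar) = 0"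
    unfolding v(2) by simp
  then have "grad f xstar \<bullet> (x - xstar)
      = - ((transpose A *v ystar) \<bullet> (x - xstar)) - v \<bullet> (x - xstar)"
    unfolding inner_add_left by linarith
  also have "(transpose A *v ystar) \<bullet> (x - xstar) = ystar \<bullet> (A *v x - b)"
    unfolding inner_transpose_mult_vec by (simp add: matrix_vector_mult_diff_distrib b)
  finally show ?thesis
    using convex_on_above_tangent_plane[OF assms(1) GDERIV_grad[OF assms(2)], of x] v(1) \<open>x \<in> Q\<close>
    by (force simp: normal_cone_def)
qed

lemma norm_add_scaleR_sq:
  fixes u r :: "'a::real_inner"
  shows "(norm (u + c *\<^sub>R r))\<^sup>2 = (norm u)\<^sup>2 + 2 * c * (u \<bullet> r + c / 2 * (norm r)\<^sup>2)"
  unfolding power2_norm_eq_inner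
  by (simp add: inner_add_left inner_add_right inner_commute[of r u] distrib_left)

text \<open>One multiplier update. Near-optimality of \<open>x\<close> is needed only relative to the feasible point
  \<open>xstar\<close>, where the Lagrangian equals \<open>f xstar\<close>; with the saddle inequality it bounds
  \<open>(y - ystar) \<bullet> r + \<beta> / 2 * (norm r)\<^sup>2\<close> by \<open>e\<close>, and \<open>2 * \<beta>\<close> times this quantity is exactly the
  increment of the squared distance to \<open>ystar\<close>.\<close>

lemma iALM_dual_step:
  fixes f :: "real ^ 'n \<Rightarrow> real" and A :: "real ^ 'n ^ 'm"
  assumes "convex_on UNIV f" and "f differentiable (at xstar)"
    and "KKT_point f Q A b xstar ystar" and "x \<in> Q" and "0 \<le> \<beta>"
    and opt: "aug_lagrangian f A b \<beta> x y \<le> aug_lagrangian f A b \<beta> xstar y + e"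
  shows "(norm (y + \<beta> *\<^sub>R (A *v x - b) - ystar))\<^sup>2 \<le> (norm (y - ystar))\<^sup>2 + 2 * (\<beta> * e)"
proof -
  let ?r = "A *v x - b"
  have "A *v xstar = b"
    using assms(3) by (simp add: KKT_point_def)
  then have "(y - ystar) \<bullet> ?r + \<beta> / 2 * (norm ?r)\<^sup>2 \<le> e"
    using opt KKT_saddle[OF assms(1-4)] by (simp add: aug_lagrangian_def inner_diff_left)
  then have "2 * \<beta> * ((y - ystar) \<bullet> ?r + \<beta> / 2 * (norm ?r)\<^sup>2) \<le> 2 * \<beta> * e"
    using \<open>0 \<le> \<beta>\<close> by (intro mult_left_mono) auto
  moreover have "(norm (y + \<beta> *\<^sub>R ?r - ystar))\<^sup>2
      = (norm (y - ystar))\<^sup>2 + 2 * \<beta> * ((y - ystar) \<bullet> ?r + \<beta> / 2 * (norm ?r)\<^sup>2)"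
  proof -
    have "y + \<beta> *\<^sub>R ?r - ystar = (y - ystar) + \<beta> *\<^sub>R ?r"
      by simp
    then show ?thesis
      by (simp only: norm_add_scaleR_sq)
  qed
  ultimately show ?thesis by simp
qed

lemma continuous_on_aug_lagrangian:
  fixes f :: "real ^ 'n \<Rightarrow> real" and A :: "real ^ 'n ^ 'm"
  assumes "continuous_on Q f"
  shows "continuous_on Q (\<lambda>x. aug_lagrangian f A b \<beta> x y)"
  unfolding aug_lagrangian_def
  by (intro continuous_intros assms matrix_vector_mult_linear_continuous_on)

lemma iALM_dual_bound:
  fixes f :: "real ^ 'n \<Rightarrow> real" and A :: "real ^ 'n ^ 'm"
  assumes "convex_on UNIV f" and f: "\<And>x. f differentiable (at x)" and "compact Q"
    and KKT: "KKT_point f Q A b xstar ystar" and run: "iALM f Q A b K \<beta>s \<epsilon>s xs ys"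
    and \<beta>s: "\<And>j. j < K \<Longrightarrow> 0 \<le> \<beta>s j" and "(\<Sum>j<K. \<beta>s j * \<epsilon>s j) \<le> C / 2" and "k \<le> K"
  shows "norm (ys k) \<le> 2 * norm ystar + sqrt C"
proof -
  \<comment> \<open>The normal cone is empty outside \<open>Q\<close>.\<close>
  have xstar: "xstar \<in> Q"
    using KKT by (auto simp: KKT_point_def normal_cone_def)
  have "continuous_on Q f"
    using f by (simp add: continuous_at_imp_continuous_on differentiable_imp_continuous_within)
  \<comment> \<open>Without a lower bound, the infimum in the accuracy condition would say nothing.\<close>
  then have bdd: "bdd_below ((\<lambda>x. aug_lagrangian f A b c x y) ` Q)" for c y
    using \<open>compact Q\<close> by (intro bounded_imp_bdd_below compact_imp_bounded
        compact_continuous_image continuous_on_aug_lagrangian)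
  have step: "(norm (ys (Suc j) - ystar))\<^sup>2 \<le> (norm (ys j - ystar))\<^sup>2 + 2 * (\<beta>s j * \<epsilon>s j)"
    and eps: "0 \<le> \<epsilon>s j" if "j < K" for j
  proof -
    let ?m = "INF x\<in>Q. aug_lagrangian f A b (\<beta>s j) x (ys j)"
    have Q: "xs (Suc j) \<in> Q"
      and opt: "aug_lagrangian f A b (\<beta>s j) (xs (Suc j)) (ys j) - ?m \<le> \<epsilon>s j"
      and ys: "ys (Suc j) = ys j + \<beta>s j *\<^sub>R (A *v xs (Suc j) - b)"
      using run that by (auto simp: iALM_def)
    show "0 \<le> \<epsilon>s j"
      using opt cINF_lower[OF bdd Q, of "\<beta>s j" "ys j"] by linarith
    have "aug_lagrangian f A b (\<beta>s j) (xs (Suc j)) (ys j)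
        \<le> aug_lagrangian f A b (\<beta>s j) xstar (ys j) + \<epsilon>s j"
      using opt cINF_lower[OF bdd xstar, of "\<beta>s j" "ys j"] by linarith
    then show "(norm (ys (Suc j) - ystar))\<^sup>2 \<le> (norm (ys j - ystar))\<^sup>2 + 2 * (\<beta>s j * \<epsilon>s j)"
      unfolding ys by (rule iALM_dual_step[OF assms(1) f KKT Q \<beta>s[OF that]])
  qed
  have "(norm (ys k - ystar))\<^sup>2 \<le> (norm ystar)\<^sup>2 + 2 * (\<Sum>j<k. \<beta>s j * \<epsilon>s j)"
    using \<open>k \<le> K\<close>
  proof (induction k)
    case 0
    then show ?case using run by (simp add: iALM_def)
  next
    case (Suc k)
    then show ?case using step[of k] by (simp add: distrib_left)
  qed
  \<comment> \<open>The accuracies are nonnegative, as no point of \<open>Q\<close> has a value below the infimum.\<close>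
  also have "(\<Sum>j<k. \<beta>s j * \<epsilon>s j) \<le> (\<Sum>j<K. \<beta>s j * \<epsilon>s j)"
    using \<open>k \<le> K\<close> \<beta>s eps by (intro sum_mono2) auto
  also have "\<dots> \<le> C / 2" by fact
  finally have sq: "(norm (ys k - ystar))\<^sup>2 \<le> (norm ystar)\<^sup>2 + C" by simp
  have "0 \<le> (\<Sum>j<K. \<beta>s j * \<epsilon>s j)"
    using \<beta>s eps by (intro sum_nonneg) auto
  with assms(7) have "0 \<le> C" by linarith
  have "norm (ys k - ystar) \<le> sqrt ((norm ystar)\<^sup>2 + C)"
    using sq by (rule real_le_rsqrt)
  also have "\<dots> \<le> norm ystar + sqrt C"
    using sqrt_add_le_add_sqrt[of "(norm ystar)\<^sup>2" C] \<open>0 \<le> C\<close> by simp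
  finally show ?thesis
    using norm_triangle_sub[of "ys k" ystar] by linarith
qed

section \<open>Boundedness of the residual on a sublevel set\<close>

lemma residual_bound:
  fixes y r :: "real ^ 'm"
  assumes "0 < \<beta>" and "norm y \<le> Y"
    and "fstar + y \<bullet> r + \<beta> / 2 * (norm r)\<^sup>2 \<le> c"
  shows "norm r \<le> sqrt (2 * (c - fstar) / \<beta> + Y\<^sup>2 / \<beta>\<^sup>2) + Y / \<beta>"
proof -
  have "- (Y * norm r) \<le> y \<bullet> r"
    using Cauchy_Schwarz_ineq2[of y r] mult_right_mono[OF assms(2), of "norm r"] by simp
  with assms(3) have "\<beta> / 2 * (norm r)\<^sup>2 - Y * norm r \<le> c - fstar" by linarith
  then have "2 / \<beta> * (\<beta> / 2 * (norm r)\<^sup>2 - Y * norm r) \<le> 2 / \<beta> * (c - fstar)"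
    using \<open>0 < \<beta>\<close> by (intro mult_left_mono) auto
  moreover have "(norm r - Y / \<beta>)\<^sup>2
      = 2 / \<beta> * (\<beta> / 2 * (norm r)\<^sup>2 - Y * norm r) + Y\<^sup>2 / \<beta>\<^sup>2"
    using \<open>0 < \<beta>\<close> by (simp add: power2_eq_square field_simps)
  ultimately have "(norm r - Y / \<beta>)\<^sup>2 \<le> 2 * (c - fstar) / \<beta> + Y\<^sup>2 / \<beta>\<^sup>2"
    by simp
  from real_le_rsqrt[OF this] show ?thesis by simp
qed

section \<open>Smoothness of the augmented Lagrangian on a sublevel set\<close>

theorem proposition1:
  fixes f :: "real ^ 'n \<Rightarrow> real" and Q :: "(real ^ 'n) set"
    and A :: "real ^ 'n ^ 'm" and b :: "real ^ 'm"
    and xstar :: "real ^ 'n" and ystar :: "real ^ 'm"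
    and xs :: "nat \<Rightarrow> real ^ 'n" and ys :: "nat \<Rightarrow> real ^ 'm"
    and \<beta>s \<rho>s \<epsilon>s :: "nat \<Rightarrow> real"
    and L0f L1f fstar C\<beta> C\<epsilon> \<epsilon> \<beta> Y R\<^sub>S B\<^sub>S L0L :: real
    and K k :: nat and x\<^sub>s :: "real ^ 'n" and L :: "real ^ 'n \<Rightarrow> real" and S :: "(real ^ 'n) set"
  assumes "convex Q" and "compact Q"
    and "convex_on UNIV f" and "L0_L1_smooth f L0f L1f"
    and "KKT_point f Q A b xstar ystar"
    and "bdd_below (range f)" and "fstar = (INF x. f x)"
    and "0 < K" and "0 < C\<beta>" and "0 < C\<epsilon>" and "0 < \<epsilon>"
    and "\<forall>j<K. \<beta>s j = C\<beta> / (real K * \<epsilon>)" and "\<forall>j<K. \<rho>s j = C\<beta> / (real K * \<epsilon>)"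
    and "(\<Sum>j<K. \<rho>s j * \<epsilon>s j) \<le> C\<epsilon> / 2"
    and "iALM f Q A b K \<beta>s \<epsilon>s xs ys"
    and "k \<le> K" and "0 < \<beta>"
    and "L = (\<lambda>x. f x + ys k \<bullet> (A *v x - b) + \<beta> / 2 * (norm (A *v x - b))\<^sup>2)"
    and "S = {x. L x \<le> L x\<^sub>s}"
    and "Y = 2 * norm ystar + sqrt C\<epsilon>"
    and "R\<^sub>S = sqrt (2 * (L x\<^sub>s - fstar) / \<beta> + Y\<^sup>2 / \<beta>\<^sup>2) + Y / \<beta>"
    and "B\<^sub>S = spectral_norm A * (Y + \<beta> * R\<^sub>S)"
    and "L0L = L0f + \<beta> * spectral_norm (transpose A ** A) + L1f * B\<^sub>S"
  shows "L0_L1_smooth_on S L L0L L1f"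
proof -
  have f2: "twice_differentiable f" and L: "0 < L0f" "0 < L1f"
    using assms(4) by (auto simp: L0_L1_smooth_on_def)
  have L_eq: "L = (\<lambda>x. aug_lagrangian f A b \<beta> x (ys k))"
    unfolding assms(18) aug_lagrangian_def ..
  have "(\<Sum>j<K. \<beta>s j * \<epsilon>s j) = (\<Sum>j<K. \<rho>s j * \<epsilon>s j)"
    using assms(12,13) by (intro sum.cong) auto
  then have y: "norm (ys k) \<le> Y"
    unfolding assms(20) using f2 assms(8-15)
    by (intro iALM_dual_bound[OF assms(3) _ assms(2,5,15) _ _ assms(16)])
      (auto simp: twice_differentiable_def)
  have r: "norm (A *v x - b) \<le> R\<^sub>S" if "x \<in> S" for x
    unfolding assms(21)
  proof (rule residual_bound[OF assms(17) y])
    have "fstar \<le> f x"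
      unfolding assms(7) using assms(6) by (intro cINF_lower) auto
    moreover have "L x \<le> L x\<^sub>s"
      using that by (simp add: assms(19))
    ultimately show "fstar + ys k \<bullet> (A *v x - b) + \<beta> / 2 * (norm (A *v x - b))\<^sup>2 \<le> L x\<^sub>s"
      by (simp add: assms(18))
  qed
  \<comment> \<open>As \<open>sqrt\<close> is negative at negative arguments, \<open>R\<^sub>S \<ge> 0\<close> needs a reason: the starting point
    itself lies in \<open>S\<close>.\<close>
  have "0 \<le> R\<^sub>S"
    using order_trans[OF norm_ge_zero r[of x\<^sub>s]] by (simp add: assms(19))
  moreover have "0 \<le> Y"
    using y norm_ge_zero[of "ys k"] by linarith
  ultimately have "0 < L0L"
    unfolding assms(22,23) using L \<open>0 < \<beta>\<close>
    by (intro add_pos_nonneg mult_nonneg_nonneg add_nonneg_nonneg spectral_norm_nonneg) auto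
  then show ?thesis
    unfolding L0_L1_smooth_on_def
    using L twice_differentiable_aug_lagrangian[OF f2, of A b \<beta> "ys k"]
      aug_lagrangian_hessian_bound[OF assms(4) less_imp_le[OF \<open>0 < \<beta>\<close>] y r]
    by (simp add: L_eq assms(22,23))
qed

end
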